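(* Let $\theta\in(-\pi/4,\pi/4)$ (equivalently $\sin 2\theta = Z/(2m)$ with $|Z|<2m$, the non-BPS case), and let $\mathcal M\in\Lambda$ be supersymmetric, i.e. $Q^A_\alpha\mathcal M=0$ and $\tilde Q_{\dot\alpha A}\mathcal M=0$ for all $A,\alpha,\dot\alpha\in\{1,2\}$. Then $$\mathcal M=\delta^1\delta^2\,\mathcal M_{res},$$ where $\mathcal M_{res}$ depends on the massive Grassmann variables $\eta^A_{iI}$ only through $\mathcal H^1,\mathcal H^2,\bar{\mathcal H}^1,\bar{\mathcal H}^2$; that is, $\mathcal M_{res}$ can be chosen to be a polynomial in $\mathcal H^A,\bar{\mathcal H}^A$ and $\eta_P^A$ ($A=1,2$) with complex coefficients.
   Context: Conventions. All two-valued indices are moved with $\epsilon^{12}=-\epsilon^{21}=1$, $\epsilon_{12}=-\epsilon_{21}=-1$, so $\epsilon^{ab}\epsilon_{bc}=\delta^a_c$. Repeated indices are summed. For undotted spinors $\lambda_\alpha,\mu_\alpha\in\mathbb C^2$: $\lambda^\alpha=\epsilon^{\alpha\beta}\lambda_\beta$, $\langle\lambda\mu\rangle=\lambda^\alpha\mu_\alpha$. For dotted spinors: $\tilde\mu^{\dot\alpha}=\epsilon^{\dot\alpha\dot\beta}\tilde\mu_{\dot\beta}$, $[\lambda\mu]=\tilde\lambda_{\dot\alpha}\tilde\mu^{\dot\alpha}$. Kinematics (fixed). $m>0$. For $i=1,2$ there are spinors $\lambda^I_{i\alpha},\tilde\lambda^I_{i\dot\alpha}$, $I=1,2$ (written $\mathbf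 i^I$ inside brackets) with $\langle \mathbf i^I\mathbf i^J\rangle=-m\epsilon^{IJ}$, $[\mathbf i^I\mathbf i^J]=m\epsilon^{IJ}$; momentum $p_{i\alpha\dot\alpha}=\lambda^I_{i\alpha}\epsilon_{IJ}\tilde\lambda^J_{i\dot\alpha}$. There are nonzero spinors $\lambda_{P\alpha},\tilde\lambda_{P\dot\alpha}$ (written $P$ in brackets), $P_{\alpha\dot\alpha}=\lambda_{P\alpha}\tilde\lambda_{P\dot\alpha}$, and $p_1+p_2+P=0$. The nonzero number $x$ is defined by $x\lambda_{P\alpha}=\frac1m p_{1\alpha\dot\alpha}\tilde\lambda_P^{\dot\alpha}$. Grassmann variables. $\Lambda$ is the complex Grassmann (exterior) algebra on the ten generators $\eta^A_{iI}$ ($i,I,A\in\{1,2\}$) and $\eta^A_P$ ($A\in\{1,2\}$). Put $\eta_{iIA}=\epsilon_{AB}\eta^B_{iI}$. With left derivatives, $\frac{\partial}{\partial\eta_i^{IA}}=-\epsilon_{IJ}\frac{\partial}{\partial\eta^A_{iJ}}$ and $\frac{\partial}{\partial\eta^I_{iA}}=\epsilon_{IJ}\epsilon^{AB}\frac{\partial}{\partial\eta^B_{iJ}}$. Supercharges. Let $\sigma_1=1,\sigma_2=-1$, $c=\cos\theta$, $s=\sin\theta$, and $$Q^A_\alpha=\sum_{i=1}^2\lambda^I_{i\alpha}\Big(c\,\eta^A_{iI}+s\,\sigma_i\frac{\partial}{\partial\eta^I_{iA}}\Big)+\lambda_{P\alpha}\eta^A_P,\qquad \tilde Q_{\dot\alpha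 A}=\sum_{i=1}^2\tilde\lambda^I_{i\dot\alpha}\Big(c\frac{\partial}{\partial\eta_i^{IA}}-s\,\sigma_i\eta_{iIA}\Big)+\tilde\lambda_{P\dot\alpha}\frac{\partial}{\partial\eta^A_P}.$$ Building blocks. Fix reference spinors $\zeta$ (undotted), $\xi$ (dotted) with $\langle\zeta P\rangle\ne0$, $[\xi P]\neq0$, and set $$\delta^A=\sum_i\langle P\mathbf i^I\rangle\eta^A_{iI},\quad \mathcal H^A=\frac{1}{\langle\zeta P\rangle}\sum_i\langle\zeta\mathbf i^I\rangle\eta^A_{iI},\quad \bar{\mathcal H}^A=\frac1{[\xi P]}\sum_i[\xi\mathbf i^I]\sigma_i\eta^A_{iI}.$$ (Modulo $\delta^A$, $\mathcal H^A$ and $\bar{\mathcal H}^A$ do not depend on $\zeta,\xi$.) *)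

theory Defs
  imports "HOL-Analysis.Analysis"
begin

section \<open>Grassmann algebras over the complex numbers\<close>

text \<open>
  The exterior algebra on a finite, linearly ordered set of generators.  An element is given by its
  coefficients with respect to the basis of monomials, the monomial of a set \<open>S\<close> being the
  product of the generators in \<open>S\<close> in increasing order.
\<close>

typedef 'a grassmann = "UNIV :: ('a set \<Rightarrow> complex) set"
  morphisms gcoeff Grassmann by simp

setup_lifting type_definition_grassmann

lemma grassmann_eqI: "(\<And>S. gcoeff f S = gcoeff g S) \<Longrightarrow> f = g"
  by (simp add: gcoeff_inject[symmetric] fun_eq_iff)

text \<open>The sign from sorting the monomial of \<open>S\<close> followed by that of \<open>T\<close>, for disjoint \<open>S\<close>, \<open>T\<close>.\<close>

definition shuffle_sign :: "'a::linorder set \<Rightarrow> 'a set \<Rightarrow> complex" where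
  "shuffle_sign S T = (- 1) ^ card {(a, b) \<in> S \<times> T. b < a}"

lemma shuffle_sign_empty [simp]: "shuffle_sign {} T = 1" "shuffle_sign S {} = 1"
  by (simp_all add: shuffle_sign_def)

lemma shuffle_sign_Un_left:
  fixes A B C :: "'a::{finite,linorder} set"
  assumes "A \<inter> B = {}"
  shows "shuffle_sign (A \<union> B) C = shuffle_sign A C * shuffle_sign B C"
proof -
  have "{(a, b) \<in> (A \<union> B) \<times> C. b < a}
      = {(a, b) \<in> A \<times> C. b < a} \<union> {(a, b) \<in> B \<times> C. b < a}" by auto
  moreover have "{(a, b) \<in> A \<times> C. b < a} \<inter> {(a, b) \<in> B \<times> C. b < a} = {}"
    using assms by auto
  ultimately show ?thesis
    by (simp add: shuffle_sign_def card_Un_disjoint power_add)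
qed

lemma shuffle_sign_Un_right:
  fixes A B C :: "'a::{finite,linorder} set"
  assumes "B \<inter> C = {}"
  shows "shuffle_sign A (B \<union> C) = shuffle_sign A B * shuffle_sign A C"
proof -
  have "{(a, b) \<in> A \<times> (B \<union> C). b < a}
      = {(a, b) \<in> A \<times> B. b < a} \<union> {(a, b) \<in> A \<times> C. b < a}" by auto
  moreover have "{(a, b) \<in> A \<times> B. b < a} \<inter> {(a, b) \<in> A \<times> C. b < a} = {}"
    using assms by auto
  ultimately show ?thesis
    by (simp add: shuffle_sign_def card_Un_disjoint power_add)
qed

lemma shuffle_sign_singleton:
  "shuffle_sign {a} {b} = (if b < a then - 1 else 1)"
proof -
  have "{(a', b'). a' = a \<and> b' = b \<and> b' < a'} = (if b < a then {(a, b)} else {})" by auto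
  then show ?thesis by (simp add: shuffle_sign_def)
qed

instantiation grassmann :: ("{finite,linorder}") ring_1
begin

lift_definition zero_grassmann :: "'a grassmann" is "\<lambda>S. 0" .
lift_definition one_grassmann :: "'a grassmann" is "\<lambda>S. if S = {} then 1 else 0" .
lift_definition plus_grassmann :: "'a grassmann \<Rightarrow> 'a grassmann \<Rightarrow> 'a grassmann"
  is "\<lambda>f g S. f S + g S" .
lift_definition minus_grassmann :: "'a grassmann \<Rightarrow> 'a grassmann \<Rightarrow> 'a grassmann"
  is "\<lambda>f g S. f S - g S" .
lift_definition uminus_grassmann :: "'a grassmann \<Rightarrow> 'a grassmann" is "\<lambda>f S. - f S" .
lift_definition times_grassmann :: "'a grassmann \<Rightarrow> 'a grassmann \<Rightarrow> 'a grassmann"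
  is "\<lambda>f g U. \<Sum>S\<in>Pow U. shuffle_sign S (U - S) * f S * g (U - S)" .

instance
proof
  fix f g h :: "'a grassmann"
  show "f * g * h = f * (g * h)"
  proof (transfer, rule ext)
    fix f g h :: "'a set \<Rightarrow> complex" and U :: "'a set"
    let ?G = "\<lambda>S T. shuffle_sign S (U - S) * shuffle_sign T (S - T) * f T * g (S - T) * h (U - S)"
    let ?H = "\<lambda>S T. shuffle_sign S (U - S) * shuffle_sign T (U - S - T) * f S * g T * h (U - S - T)"
    have "(\<Sum>S\<in>Pow U. shuffle_sign S (U - S) *
            (\<Sum>T\<in>Pow S. shuffle_sign T (S - T) * f T * g (S - T)) * h (U - S))
        = (\<Sum>S\<in>Pow U. \<Sum>T\<in>Pow S. ?G S T)"
      by (simp add: sum_distrib_left sum_distrib_right mult_ac)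
    also have "\<dots> = (\<Sum>(S, T)\<in>Sigma (Pow U) Pow. ?G S T)"
      by (rule sum.Sigma) auto
    also have "\<dots> = (\<Sum>(S, T)\<in>Sigma (Pow U) (\<lambda>S. Pow (U - S)). ?H S T)"
    proof (rule sum.reindex_bij_witness[where j = "\<lambda>(S, T). (T, S - T)" and i = "\<lambda>(S, T). (S \<union> T, S)"],
        goal_cases)
      case (5 p)
      then obtain S T where p: "p = (S, T)" "T \<subseteq> S" "S \<subseteq> U" by auto
      have 1: "U - T - (S - T) = U - S" and 2: "S = T \<union> (S - T)" and 3: "U - T = (S - T) \<union> (U - S)"
        using p by auto
      have "shuffle_sign S (U - S) = shuffle_sign T (U - S) * shuffle_sign (S - T) (U - S)"
        by (subst 2) (rule shuffle_sign_Un_left, auto)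
      moreover have "shuffle_sign T (U - T) = shuffle_sign T (S - T) * shuffle_sign T (U - S)"
        by (subst 3) (rule shuffle_sign_Un_right, auto)
      ultimately show ?case by (simp add: p(1) 1 mult_ac)
    qed auto
    also have "\<dots> = (\<Sum>S\<in>Pow U. \<Sum>T\<in>Pow (U - S). ?H S T)"
      by (rule sum.Sigma[symmetric]) auto
    also have "\<dots> = (\<Sum>S\<in>Pow U. shuffle_sign S (U - S) * f S *
            (\<Sum>T\<in>Pow (U - S). shuffle_sign T (U - S - T) * g T * h (U - S - T)))"
      by (simp add: sum_distrib_left mult_ac)
    finally show "(\<Sum>S\<in>Pow U. shuffle_sign S (U - S) *
            (\<Sum>T\<in>Pow S. shuffle_sign T (S - T) * f T * g (S - T)) * h (U - S))
        = (\<Sum>S\<in>Pow U. shuffle_sign S (U - S) * f S *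
            (\<Sum>T\<in>Pow (U - S). shuffle_sign T (U - S - T) * g T * h (U - S - T)))" .
  qed
  show "f + g + h = f + (g + h)" "f + g = g + f" "0 + f = f" "- f + f = 0" "f - g = f + - g"
    by (transfer; simp add: fun_eq_iff)+
  show "(f + g) * h = f * h + g * h" "f * (g + h) = f * g + f * h"
    by (transfer; simp add: fun_eq_iff algebra_simps sum.distrib)+
  show "1 * f = f"
  proof (transfer, rule ext)
    fix f :: "'a set \<Rightarrow> complex" and U :: "'a set"
    have "(\<Sum>S\<in>Pow U. shuffle_sign S (U - S) * (if S = {} then 1 else 0) * f (U - S))
        = (\<Sum>S\<in>Pow U. if S = {} then f U else 0)"
      by (rule sum.cong) auto
    then show "(\<Sum>S\<in>Pow U. shuffle_sign S (U - S) * (if S = {} then 1 else 0) * f (U - S)) = f U"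
      by simp
  qed
  show "f * 1 = f"
  proof (transfer, rule ext)
    fix f :: "'a set \<Rightarrow> complex" and U :: "'a set"
    have "(\<Sum>S\<in>Pow U. shuffle_sign S (U - S) * f S * (if U - S = {} then 1 else 0))
        = (\<Sum>S\<in>Pow U. if S = U then f U else 0)"
      by (rule sum.cong) auto
    then show "(\<Sum>S\<in>Pow U. shuffle_sign S (U - S) * f S * (if U - S = {} then 1 else 0)) = f U"
      by simp
  qed
  show "(0 :: 'a grassmann) \<noteq> 1"
    by transfer (auto simp: fun_eq_iff)
qed

end

lift_definition gscale :: "complex \<Rightarrow> 'a grassmann \<Rightarrow> 'a grassmann"  (infixr "*\<^sub>C" 75)
  is "\<lambda>c f S. c * f S" .

lift_definition gvar :: "'a \<Rightarrow> 'a grassmann" is "\<lambda>a S. if S = {a} then 1 else 0" .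

text \<open>The left derivative: a monomial \<open>a \<cdot> S\<close> (with \<open>a \<notin> S\<close>) is sent to \<open>S\<close>.\<close>

lift_definition left_deriv :: "'a::{finite,linorder} \<Rightarrow> 'a grassmann \<Rightarrow> 'a grassmann"
  is "\<lambda>a f S. if a \<in> S then 0 else shuffle_sign {a} S * f (insert a S)" .

text \<open>
  The complex unital subalgebra generated by a set, that is, the set of all polynomials with complex
  coefficients in the elements of that set.
\<close>

inductive_set gpolys :: "'a::{finite,linorder} grassmann set \<Rightarrow> 'a grassmann set"
  for G :: "'a grassmann set" where
  const: "c *\<^sub>C 1 \<in> gpolys G"
| gen: "g \<in> G \<Longrightarrow> g \<in> gpolys G"
| add: "f \<in> gpolys G \<Longrightarrow> g \<in> gpolys G \<Longrightarrow> f + g \<in> gpolys G"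
| mult: "f \<in> gpolys G \<Longrightarrow> g \<in> gpolys G \<Longrightarrow> f * g \<in> gpolys G"

lemma gscale_mult_left: "(c *\<^sub>C f) * g = c *\<^sub>C (f * (g :: 'a::{finite,linorder} grassmann))"
  by transfer (simp add: fun_eq_iff sum_distrib_left mult_ac)

lemma gscale_mult_right: "f * (c *\<^sub>C g) = c *\<^sub>C (f * (g :: 'a::{finite,linorder} grassmann))"
  by transfer (simp add: fun_eq_iff sum_distrib_left mult_ac)

lemma gcoeff_gvar_mult:
  "gcoeff (gvar b * f) U =
     (if b \<in> U then shuffle_sign {b} (U - {b}) * gcoeff f (U - {b}) else 0)"
proof -
  have "gcoeff (gvar b * f) U
      = (\<Sum>S\<in>Pow U. if S = {b} then shuffle_sign {b} (U - {b}) * gcoeff f (U - {b}) else 0)"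
    unfolding times_grassmann.rep_eq gvar.rep_eq by (rule sum.cong) auto
  then show ?thesis by simp
qed

lemma gvar_square: "gvar a * gvar a = (0 :: 'a::{finite,linorder} grassmann)"
  by (rule grassmann_eqI) (auto simp: gcoeff_gvar_mult gvar.rep_eq zero_grassmann.rep_eq)

lemma gvar_anticommute: "gvar a * gvar b = - (gvar b * (gvar a :: 'a::{finite,linorder} grassmann))"
proof (cases "a = b")
  case True
  then show ?thesis by (simp add: gvar_square)
next
  case False
  show ?thesis
  proof (rule grassmann_eqI)
    fix U :: "'a set"
    have 1: "a \<in> U \<and> U - {a} = {b} \<longleftrightarrow> U = {a, b}" and 2: "b \<in> U \<and> U - {b} = {a} \<longleftrightarrow> U = {a, b}"
      using False by auto
    have 3: "{a, b} - {a} = {b}" "{a, b} - {b} = {a}" using False by auto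
    show "gcoeff (gvar a * gvar b) U = gcoeff (- (gvar b * gvar a)) U"
    proof (cases "U = {a, b}")
      case True
      then show ?thesis using False
        by (auto simp: gcoeff_gvar_mult gvar.rep_eq uminus_grassmann.rep_eq 3 shuffle_sign_singleton)
    next
      case U: False
      then show ?thesis using 1 2
        by (auto simp: gcoeff_gvar_mult gvar.rep_eq uminus_grassmann.rep_eq)
    qed
  qed
qed

lemma left_deriv_add: "left_deriv a (f + g) = left_deriv a f + left_deriv a g"
  by transfer (auto simp: fun_eq_iff algebra_simps)

lemma left_deriv_gscale: "left_deriv a (c *\<^sub>C f) = c *\<^sub>C left_deriv a f"
  by transfer (auto simp: fun_eq_iff algebra_simps)

lemma left_deriv_one [simp]: "left_deriv a 1 = 0"
  by transfer (auto simp: fun_eq_iff)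

lemma left_deriv_gvar_mult:
  "left_deriv a (gvar b * f) = (if a = b then f else 0) - gvar b * left_deriv a f"
proof (rule grassmann_eqI)
  fix U
  have sq: "shuffle_sign S T * shuffle_sign S T = 1" for S T :: "'a set"
    by (simp add: shuffle_sign_def flip: power_mult_distrib)
  have sq': "shuffle_sign S T * (shuffle_sign S T * z) = z" for S T :: "'a set" and z
    using sq[of S T] by (simp flip: mult.assoc)
  show "gcoeff (left_deriv a (gvar b * f)) U
      = gcoeff ((if a = b then f else 0) - gvar b * left_deriv a f) U"
  proof (cases "a = b")
    case True
    then show ?thesis
      by (auto simp: left_deriv.rep_eq gcoeff_gvar_mult minus_grassmann.rep_eq sq' insert_absorb)
  next
    case ab: False
    show ?thesis
    proof (cases "a \<in> U \<or> b \<notin> U")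
      case True
      then show ?thesis using ab
        by (auto simp: left_deriv.rep_eq gcoeff_gvar_mult uminus_grassmann.rep_eq)
    next
      case False
      define V where "V = U - {b}"
      have U: "U = insert b V" "a \<notin> V" "b \<notin> V" using False by (auto simp: V_def)
      have e: "insert a U - {b} = insert a V" "U - {b} = V" using ab U by auto
      have s1: "shuffle_sign {b} (insert a V) = shuffle_sign {b} {a} * shuffle_sign {b} V"
        using shuffle_sign_Un_right[of "{a}" V "{b}"] U by simp
      have s2: "shuffle_sign {a} U = shuffle_sign {a} {b} * shuffle_sign {a} V"
        using shuffle_sign_Un_right[of "{b}" V "{a}"] U by simp
      have s3: "shuffle_sign {a} {b} * shuffle_sign {b} {a} = (-1 :: complex)"
        using ab by (auto simp: shuffle_sign_singleton)
      have s3': "shuffle_sign {a} {b} * (shuffle_sign {b} {a} * z) = - z" for z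
        using s3 by (simp flip: mult.assoc)
      show ?thesis using False ab U(2)
        by (simp add: left_deriv.rep_eq gcoeff_gvar_mult uminus_grassmann.rep_eq
            e s1 s2 s3' mult.assoc mult.left_commute[of "shuffle_sign {a} V"])
    qed
  qed
qed

section \<open>Two-valued indices and spinor brackets\<close>

text \<open>Two-valued indices have type \<^typ>\<open>2\<close>, whose elements are \<open>1\<close> and \<open>2\<close> (the latter equal to \<open>0\<close>).\<close>

definition eps_up :: "2 \<Rightarrow> 2 \<Rightarrow> complex" where
  "eps_up a b = (if a = b then 0 else if a = 1 then 1 else - 1)"

definition eps_dn :: "2 \<Rightarrow> 2 \<Rightarrow> complex" where
  "eps_dn a b = (if a = b then 0 else if a = 1 then - 1 else 1)"

lemma eps_up_eps_dn: "(\<Sum>b\<in>UNIV. eps_up a b * eps_dn b c) = (if a = c then 1 else 0)"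
  using exhaust_2[of a] exhaust_2[of c] by (auto simp: sum_2 eps_up_def eps_dn_def)

text \<open>Spinors, dotted or undotted, are given by their components with lower index.\<close>

type_synonym spinor = "complex ^ 2"

definition raise :: "spinor \<Rightarrow> spinor" where
  "raise u = (\<chi> a. \<Sum>b\<in>UNIV. eps_up a b * u $ b)"

definition angle :: "spinor \<Rightarrow> spinor \<Rightarrow> complex" where
  "angle u v = (\<Sum>a\<in>UNIV. raise u $ a * v $ a)"

definition square :: "spinor \<Rightarrow> spinor \<Rightarrow> complex" where
  "square u v = (\<Sum>a\<in>UNIV. u $ a * raise v $ a)"

text \<open>
  Families \<open>l\<close>, \<open>lt\<close> of massive spinors take the particle label \<open>i\<close> and then the little-group
  index \<open>I\<close> (upper).  Momenta have an undotted and then a dotted lower index.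
\<close>

definition massive_momentum ::
  "(2 \<Rightarrow> 2 \<Rightarrow> spinor) \<Rightarrow> (2 \<Rightarrow> 2 \<Rightarrow> spinor) \<Rightarrow> 2 \<Rightarrow> complex ^ 2 ^ 2" where
  "massive_momentum l lt i =
     (\<chi> a d. \<Sum>I\<in>UNIV. \<Sum>J\<in>UNIV. l i I $ a * eps_dn I J * lt i J $ d)"

definition massless_momentum :: "spinor \<Rightarrow> spinor \<Rightarrow> complex ^ 2 ^ 2" where
  "massless_momentum lP ltP = (\<chi> a d. lP $ a * ltP $ d)"

section \<open>The ten Grassmann variables\<close>

text \<open>\<open>Eta A i I\<close> stands for \<open>\<eta>\<^sup>A\<^bsub>iI\<^esub>\<close> and \<open>EtaP A\<close> for \<open>\<eta>\<^sup>A\<^bsub>P\<^esub>\<close>.\<close>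

datatype gen = Eta 2 2 2 | EtaP 2

text \<open>An arbitrary linear order of the generators; it only fixes the monomial basis.\<close>

fun gen_rank :: "gen \<Rightarrow> nat" where
  "gen_rank (Eta A i I) = 4 * (if A = 1 then 0 else 1) + 2 * (if i = 1 then 0 else 1) + (if I = 1 then 0 else 1)"
| "gen_rank (EtaP A) = 8 + (if A = 1 then 0 else 1)"

lemma gen_rank_inject: "gen_rank g = gen_rank h \<Longrightarrow> g = h"
proof -
  have two: "a = b" if "(a = 1) = (b = 1)" for a b :: 2
    using that exhaust_2[of a] exhaust_2[of b] by auto
  show "gen_rank g = gen_rank h \<Longrightarrow> g = h"
    by (cases g; cases h) (auto split: if_splits intro: two)
qed

instantiation gen :: linorder
begin

definition "g \<le> h \<longleftrightarrow> gen_rank g \<le> gen_rank h"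
definition "g < h \<longleftrightarrow> gen_rank g < gen_rank h"

instance
  by standard (auto simp: less_eq_gen_def less_gen_def intro: gen_rank_inject)

end

instance gen :: finite
proof
  have "(UNIV :: gen set) = range (\<lambda>(A, i, I). Eta A i I) \<union> range EtaP"
  proof (rule set_eqI)
    fix g show "g \<in> UNIV \<longleftrightarrow> g \<in> range (\<lambda>(A, i, I). Eta A i I) \<union> range EtaP"
      by (cases g) (auto simp: image_iff)
  qed
  then show "finite (UNIV :: gen set)" by (metis finite_Un finite_imageI finite)
qed

abbreviation eta :: "2 \<Rightarrow> 2 \<Rightarrow> 2 \<Rightarrow> gen grassmann" where
  "eta A i I \<equiv> gvar (Eta A i I)"

abbreviation etaP :: "2 \<Rightarrow> gen grassmann" where
  "etaP A \<equiv> gvar (EtaP A)"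

text \<open>\<open>\<eta>\<^bsub>iIA\<^esub>\<close>, with all indices lowered.\<close>

definition eta_low :: "2 \<Rightarrow> 2 \<Rightarrow> 2 \<Rightarrow> gen grassmann" where
  "eta_low i I A = (\<Sum>B\<in>UNIV. eps_dn A B *\<^sub>C eta B i I)"

text \<open>The derivatives with respect to \<open>\<eta>\<^sub>i\<^bsup>IA\<^esup>\<close> and \<open>\<eta>\<^sup>I\<^bsub>iA\<^esub>\<close>, respectively.\<close>

definition deriv_upIA :: "2 \<Rightarrow> 2 \<Rightarrow> 2 \<Rightarrow> gen grassmann \<Rightarrow> gen grassmann" where
  "deriv_upIA i I A f = - (\<Sum>J\<in>UNIV. eps_dn I J *\<^sub>C left_deriv (Eta A i J) f)"

definition deriv_upI_lowA :: "2 \<Rightarrow> 2 \<Rightarrow> 2 \<Rightarrow> gen grassmann \<Rightarrow> gen grassmann" where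
  "deriv_upI_lowA i I A f =
     (\<Sum>J\<in>UNIV. \<Sum>B\<in>UNIV. (eps_dn I J * eps_up A B) *\<^sub>C left_deriv (Eta B i J) f)"

section \<open>Supercharges and building blocks\<close>

definition sig :: "2 \<Rightarrow> complex" where
  "sig i = (if i = 1 then 1 else - 1)"

definition superQ :: "real \<Rightarrow> (2 \<Rightarrow> 2 \<Rightarrow> spinor) \<Rightarrow> spinor \<Rightarrow> 2 \<Rightarrow> 2 \<Rightarrow> gen grassmann \<Rightarrow> gen grassmann" where
  "superQ \<theta> l lP A \<alpha> f =
     (\<Sum>i\<in>UNIV. \<Sum>I\<in>UNIV. (l i I $ \<alpha>) *\<^sub>C
        (complex_of_real (cos \<theta>) *\<^sub>C (eta A i I * f)
         + (complex_of_real (sin \<theta>) * sig i) *\<^sub>C deriv_upI_lowA i I A f))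
     + (lP $ \<alpha>) *\<^sub>C (etaP A * f)"

definition superQt :: "real \<Rightarrow> (2 \<Rightarrow> 2 \<Rightarrow> spinor) \<Rightarrow> spinor \<Rightarrow> 2 \<Rightarrow> 2 \<Rightarrow> gen grassmann \<Rightarrow> gen grassmann" where
  "superQt \<theta> lt ltP \<alpha> A f =
     (\<Sum>i\<in>UNIV. \<Sum>I\<in>UNIV. (lt i I $ \<alpha>) *\<^sub>C
        (complex_of_real (cos \<theta>) *\<^sub>C deriv_upIA i I A f
         - (complex_of_real (sin \<theta>) * sig i) *\<^sub>C (eta_low i I A * f)))
     + (ltP $ \<alpha>) *\<^sub>C left_deriv (EtaP A) f"

definition delta :: "(2 \<Rightarrow> 2 \<Rightarrow> spinor) \<Rightarrow> spinor \<Rightarrow> 2 \<Rightarrow> gen grassmann" where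
  "delta l lP A = (\<Sum>i\<in>UNIV. \<Sum>I\<in>UNIV. angle lP (l i I) *\<^sub>C eta A i I)"

definition calH :: "spinor \<Rightarrow> (2 \<Rightarrow> 2 \<Rightarrow> spinor) \<Rightarrow> spinor \<Rightarrow> 2 \<Rightarrow> gen grassmann" where
  "calH \<zeta> l lP A = (1 / angle \<zeta> lP) *\<^sub>C (\<Sum>i\<in>UNIV. \<Sum>I\<in>UNIV. angle \<zeta> (l i I) *\<^sub>C eta A i I)"

definition calHbar :: "spinor \<Rightarrow> (2 \<Rightarrow> 2 \<Rightarrow> spinor) \<Rightarrow> spinor \<Rightarrow> 2 \<Rightarrow> gen grassmann" where
  "calHbar \<xi> lt ltP A =
     (1 / square \<xi> ltP) *\<^sub>C (\<Sum>i\<in>UNIV. \<Sum>I\<in>UNIV. (square \<xi> (lt i I) * sig i) *\<^sub>C eta A i I)"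

end

theory Submission
  imports Defs
begin

text \<open>
  Since \<open>[i P]\<close> is \<open>x \<sigma>\<^sub>i\<close> times \<open>\<langle>P i\<rangle>\<close>, contracting both supercharges with the massless spinors leaves
  linear equations between \<open>\<delta>\<^sup>A M\<close> and \<open>D\<^sub>A M\<close> for a single derivative \<open>D\<^sub>A\<close> per flavour, with determinant
  \<open>c\<^sup>2 - s\<^sup>2 = cos (2 \<theta>) \<noteq> 0\<close>.  Hence \<open>\<delta>\<^sup>A M = 0\<close>, so that \<open>\<delta>\<^sup>1 \<delta>\<^sup>2\<close> factors out of \<open>M\<close>, and \<open>D\<^sub>A M = 0\<close>, so that
  \<open>M\<close> is a polynomial in the linear forms annihilated by \<open>D\<^sub>A\<close>.  By momentum conservation these are
  spanned by \<open>\<delta>\<^sup>A\<close>, \<open>H\<^sup>A\<close> and its barred analogue.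
\<close>

section \<open>Coefficients, scalars and induction in the Grassmann algebra\<close>

lemmas gcoeff_linear = plus_grassmann.rep_eq minus_grassmann.rep_eq uminus_grassmann.rep_eq
  gscale.rep_eq zero_grassmann.rep_eq

lemma gcoeff_sum: "gcoeff (sum f S) U = (\<Sum>x\<in>S. gcoeff (f x) U)"
  for f :: "'b \<Rightarrow> 'a::{finite,linorder} grassmann"
  by (induction S rule: infinite_finite_induct) (simp_all add: gcoeff_linear)

lemma gscale_zero_right [simp]: "c *\<^sub>C 0 = (0 :: 'a::{finite,linorder} grassmann)"
  by transfer simp

lemma gscale_zero_left [simp]: "0 *\<^sub>C f = (0 :: 'a::{finite,linorder} grassmann)"
  by transfer simp

lemma gscale_one [simp]: "1 *\<^sub>C f = f"
  by transfer simp

text \<open>Up to a sign, every basis monomial arises from \<open>1\<close> by left multiplication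
  with generators, and every element is a finite linear combination of monomials.\<close>

lemma grassmann_induct [case_names zero one add scale gvar]:
  fixes f :: "'a::{finite,linorder} grassmann"
  assumes zero: "P 0" and one: "P 1" and add: "\<And>f g. P f \<Longrightarrow> P g \<Longrightarrow> P (f + g)"
    and scale: "\<And>c f. P f \<Longrightarrow> P (c *\<^sub>C f)" and gvar: "\<And>a f. P f \<Longrightarrow> P (gvar a * f)"
  shows "P f"
proof -
  define mon :: "'a set \<Rightarrow> 'a grassmann" where "mon S = Grassmann (\<lambda>U. if U = S then 1 else 0)" for S
  have gcoeff_mon: "gcoeff (mon S) U = (if U = S then 1 else 0)" for S U
    by (simp add: mon_def Grassmann_inverse)
  have mon: "P (mon S)" for S :: "'a set"
  proof (induction S rule: finite_induct[OF finite])
    case 1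
    have "mon {} = 1"
      by (rule grassmann_eqI) (simp add: gcoeff_mon one_grassmann.rep_eq)
    then show ?case by (simp add: one)
  next
    case (2 b S)
    have "shuffle_sign {b} S * shuffle_sign {b} S = 1"
      by (simp add: shuffle_sign_def flip: power_mult_distrib)
    then have "mon (insert b S) = shuffle_sign {b} S *\<^sub>C (gvar b * mon S)"
      using 2(2) by (intro grassmann_eqI) (auto simp: gcoeff_mon gcoeff_linear gcoeff_gvar_mult)
    then show ?case using 2 by (simp add: scale gvar)
  qed
  have "f = (\<Sum>S\<in>UNIV. gcoeff f S *\<^sub>C mon S)"
    by (rule grassmann_eqI) (simp add: gcoeff_sum gcoeff_linear gcoeff_mon if_distrib cong: if_cong)
  moreover have "P (\<Sum>S\<in>X. gcoeff f S *\<^sub>C mon S)" for X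
    by (induction X rule: infinite_finite_induct) (auto intro: zero add scale mon)
  ultimately show ?thesis by metis
qed

lemma gpolys_gscale:
  assumes "f \<in> gpolys G"
  shows "c *\<^sub>C f \<in> gpolys G"
proof -
  have "c *\<^sub>C f = (c *\<^sub>C 1) * f" by (simp add: gscale_mult_left)
  then show ?thesis using gpolys.mult[OF gpolys.const assms] by simp
qed

section \<open>Linear forms of one flavour and their derivatives\<close>

definition lform :: "2 \<Rightarrow> (2 \<Rightarrow> 2 \<Rightarrow> complex) \<Rightarrow> gen grassmann" where
  "lform A u = (\<Sum>i\<in>UNIV. \<Sum>I\<in>UNIV. u i I *\<^sub>C eta A i I)"

definition dform :: "2 \<Rightarrow> (2 \<Rightarrow> 2 \<Rightarrow> complex) \<Rightarrow> gen grassmann \<Rightarrow> gen grassmann" where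
  "dform A w f = (\<Sum>i\<in>UNIV. \<Sum>I\<in>UNIV. w i I *\<^sub>C left_deriv (Eta A i I) f)"

text \<open>This is the scalar that \<open>dform A w\<close> produces when applied to
  \<open>lform A u\<close>.\<close>

definition pairing :: "(2 \<Rightarrow> 2 \<Rightarrow> complex) \<Rightarrow> (2 \<Rightarrow> 2 \<Rightarrow> complex) \<Rightarrow> complex" where
  "pairing w u = (\<Sum>i\<in>UNIV. \<Sum>I\<in>UNIV. w i I * u i I)"

lemma lform_add: "lform A (\<lambda>i I. u i I + v i I) = lform A u + lform A v"
  by (rule grassmann_eqI) (simp add: lform_def sum_2 gcoeff_linear algebra_simps)

lemma lform_scale: "lform A (\<lambda>i I. c * u i I) = c *\<^sub>C lform A u"
  by (rule grassmann_eqI) (simp add: lform_def sum_2 gcoeff_linear algebra_simps)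

lemma dform_add: "dform A w (f + g) = dform A w f + dform A w g"
  by (rule grassmann_eqI) (simp add: dform_def sum_2 left_deriv_add gcoeff_linear algebra_simps)

lemma dform_gscale: "dform A w (c *\<^sub>C f) = c *\<^sub>C dform A w f"
  by (rule grassmann_eqI) (simp add: dform_def sum_2 left_deriv_gscale gcoeff_linear algebra_simps)

lemma dform_zero [simp]: "dform A w 0 = 0"
  using dform_add[of A w 0 0] by simp

lemma lform_mult: "lform A u * f = (\<Sum>i\<in>UNIV. \<Sum>I\<in>UNIV. u i I *\<^sub>C (eta A i I * f))"
  by (simp add: lform_def sum_distrib_right gscale_mult_left)

text \<open>The graded Leibniz rule for an odd derivation. The trailing factor \<open>f\<close> lets
  the rule rewrite right-nested products directly.\<close>

lemma dform_lform_mult: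
  "dform A w (lform B u * f) =
     (if A = B then pairing w u else 0) *\<^sub>C f - lform B u * dform A w f"
  by (rule grassmann_eqI)
    (simp add: dform_def lform_mult pairing_def sum_2 left_deriv_add left_deriv_gscale
      left_deriv_gvar_mult distrib_left gscale_mult_right gcoeff_linear algebra_simps)

lemma dform_etaP_mult: "dform A w (etaP B * f) = - (etaP B * dform A w f)"
  by (rule grassmann_eqI)
    (simp add: dform_def sum_2 left_deriv_gvar_mult distrib_left gscale_mult_right
      gcoeff_linear algebra_simps)

lemma dform_one [simp]: "dform A w 1 = 0"
  by (simp add: dform_def sum_2)

lemma gvar_left_commute: "gvar a * (gvar b * f) = - (gvar b * (gvar a * f))"
  for f :: "'a::{finite,linorder} grassmann"
  using gvar_anticommute[of a b] by (simp flip: mult.assoc)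

lemma gvar_lform_left_commute: "gvar a * (lform B v * f) = - (lform B v * (gvar a * f))"
  by (rule grassmann_eqI)
    (simp add: lform_mult sum_2 distrib_left gscale_mult_right gvar_left_commute[of a] gcoeff_linear)

lemma lform_left_commute: "lform A u * (lform B v * f) = - (lform B v * (lform A u * f))"
  by (rule grassmann_eqI)
    (simp add: lform_mult[of A] sum_2 distrib_left gscale_mult_right gvar_lform_left_commute gcoeff_linear)

text \<open>By anticommutation each coefficient equals its own negative.\<close>

lemma lform_square: "lform A u * (lform A u * f) = 0"
proof -
  have "gcoeff (lform A u * (lform A u * f)) S = 0" for S
    using arg_cong[OF lform_left_commute[of A u A u f], of "\<lambda>g. gcoeff g S"]
    by (simp add: gcoeff_linear)
  then show ?thesis by (intro grassmann_eqI) (simp add: gcoeff_linear)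
qed

lemma exists_dual:
  assumes "u i I \<noteq> 0"
  shows "\<exists>v. pairing v u = 1" "\<exists>v. pairing u v = 1"
proof -
  let ?v = "\<lambda>j J. if j = i \<and> J = I then 1 / u i I else 0"
  have "pairing ?v u = 1" "pairing u ?v = 1"
    using assms exhaust_2[of i] exhaust_2[of I] by (auto simp: pairing_def sum_2)
  then show "\<exists>v. pairing v u = 1" "\<exists>v. pairing u v = 1" by blast+
qed

section \<open>Elimination of a linear form\<close>

text \<open>
  If \<open>pairing w k = 1\<close>, this operator is the algebra endomorphism that sends \<open>lform A k\<close> to \<open>0\<close>
  and fixes the linear forms annihilated by \<open>w\<close>.
\<close>

definition elim :: "(2 \<Rightarrow> 2 \<Rightarrow> complex) \<Rightarrow> (2 \<Rightarrow> 2 \<Rightarrow> complex) \<Rightarrow> 2 \<Rightarrow> gen grassmann \<Rightarrow> gen grassmann" where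
  "elim w k A f = dform A w (lform A k * f)"

context
  fixes w k :: "2 \<Rightarrow> 2 \<Rightarrow> complex"
  assumes wk: "pairing w k = 1"
begin

lemma elim_eq: "elim w k A f = f - lform A k * dform A w f"
  by (simp add: elim_def dform_lform_mult wk)

text \<open>The form \<open>u\<close> is projected along \<open>k\<close> to the kernel of
  \<open>pairing w\<close>, and only in flavour \<open>A\<close>. Moving \<open>lform A k\<close>
  past \<open>lform B u\<close> gives the required sign, and the surplus term contains
  \<open>lform A k\<close> twice, hence vanishes.\<close>

lemma elim_lform_mult:
  "elim w k A (lform B u * f) =
     lform B (\<lambda>i I. u i I - (if A = B then pairing w u else 0) * k i I) * elim w k A f"
proof -
  let ?c = "if A = B then pairing w u else 0"
  have "lform B (\<lambda>i I. u i I - ?c * k i I) = lform B u + (- ?c) *\<^sub>C lform B k"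
    using lform_add[of B u "\<lambda>i I. (- ?c) * k i I"] lform_scale[of B "- ?c" k] by simp
  moreover have "lform A k * (lform B u * dform A w f) = - (lform B u * (lform A k * dform A w f))"
    by (rule lform_left_commute)
  ultimately show ?thesis
    by (intro grassmann_eqI)
      (simp add: elim_eq dform_lform_mult right_diff_distrib distrib_right gscale_mult_left
        gscale_mult_right lform_square gcoeff_linear)
qed

lemma elim_etaP_mult: "elim w k A (etaP B * f) = etaP B * elim w k A f"
  by (simp add: elim_eq dform_etaP_mult right_diff_distrib gvar_lform_left_commute)

lemma elim_add: "elim w k A (f + g) = elim w k A f + elim w k A g"
  by (simp add: elim_def distrib_left dform_add)

lemma elim_gscale: "elim w k A (c *\<^sub>C f) = c *\<^sub>C elim w k A f"
  by (simp add: elim_def gscale_mult_right dform_gscale)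

lemma elim_one: "elim w k A 1 = 1"
  by (simp add: elim_eq)

lemma elim_zero: "elim w k A 0 = 0"
  by (simp add: elim_eq)

lemma elim_fixes: "dform A w f = 0 \<Longrightarrow> elim w k A f = f"
  by (simp add: elim_eq)

end

text \<open>For a dual vector \<open>e\<close> the Leibniz rule turns
  \<open>lform A u * f = 0\<close> into \<open>f = lform A u * dform A e f\<close>: contraction with
  \<open>e\<close> is a homotopy for multiplication by the form. Doing this in both flavours
  produces two signs, which cancel.\<close>

lemma annihilated_factor:
  assumes "u i I \<noteq> 0" "lform 1 u * f = 0" "lform 2 u * f = 0"
  shows "\<exists>g. f = lform 1 u * (lform 2 u * g)"
proof -
  obtain e where e: "pairing e u = 1" using exists_dual(1)[of u i I, OF assms(1)] by blast
  have f: "f = lform A u * dform A e f" if "lform A u * f = 0" for A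
    using dform_lform_mult[of A e A u f] e that by simp
  have "f = lform 2 u * dform 2 e (lform 1 u * dform 1 e f)"
    using f[OF assms(2)] f[OF assms(3)] by simp
  also have "\<dots> = - (lform 2 u * (lform 1 u * dform 2 e (dform 1 e f)))"
    by (simp add: dform_lform_mult)
  also have "\<dots> = lform 1 u * (lform 2 u * dform 2 e (dform 1 e f))"
    by (subst lform_left_commute) simp
  finally show ?thesis by blast
qed

text \<open>
  Modulo \<open>d\<close>, the forms annihilated by \<open>w\<close> are spanned by \<open>h\<close> and \<open>hb\<close>; the factor
  \<open>lform 1 d * lform 2 d\<close> removes \<open>d\<close>.
\<close>

lemma factor_polynomial:
  fixes w k d h hb :: "2 \<Rightarrow> 2 \<Rightarrow> complex"
  defines "G \<equiv> range (\<lambda>A. lform A h) \<union> range (\<lambda>A. lform A hb) \<union> range etaP"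
  assumes wk: "pairing w k = 1" and wd: "pairing w d = 0"
    and ker: "\<And>u. pairing w u = 0 \<Longrightarrow> \<exists>a b c. \<forall>i I. u i I = a * d i I + (b * h i I + c * hb i I)"
    and M: "M = lform 1 d * (lform 2 d * N)" "dform 1 w M = 0" "dform 2 w M = 0"
  shows "\<exists>g\<in>gpolys G. M = lform 1 d * (lform 2 d * g)"
proof -
  define T where "T f = elim w k 1 (elim w k 2 f)" for f
  note elim_rules = elim_lform_mult[OF wk] elim_etaP_mult[OF wk] elim_add[OF wk] elim_gscale[OF wk]
    elim_one[OF wk] elim_zero[OF wk]
  have T_ann: "T (lform A u * f) = lform A u * T f" if "pairing w u = 0" for A u f
    using that by (simp add: T_def elim_rules)
  have T_lform: "\<exists>v. pairing w v = 0 \<and> (\<forall>f. T (lform A u * f) = lform A v * T f)" for A u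
  proof (intro exI conjI allI)
    have *: "pairing w (\<lambda>i I. u i I - pairing w u * k i I) = pairing w u - pairing w u * pairing w k"
      unfolding pairing_def by (simp add: sum_2 algebra_simps)
    then show "pairing w (\<lambda>i I. u i I - pairing w u * k i I) = 0" by (simp add: wk)
    then show "T (lform A u * f) = lform A (\<lambda>i I. u i I - pairing w u * k i I) * T f" for f
      using exhaust_2[of A] by (auto simp: T_def elim_rules)
  qed
  let ?D = "\<lambda>f. lform 1 d * (lform 2 d * f)"
  have gens: "lform A h \<in> gpolys G" "lform A hb \<in> gpolys G" "etaP A \<in> gpolys G" for A
    by (auto simp: G_def intro: gpolys.gen)
  have comm: "?D (lform A u * f) = lform A u * ?D f" for A u f
    by (simp add: lform_left_commute[of _ d A u])
  have commP: "?D (etaP A * f) = etaP A * ?D f" for A f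
    by (simp add: gvar_lform_left_commute)
  have D_d: "?D (lform A d * f) = 0" for A f
    using exhaust_2[of A] by (auto simp: comm lform_square lform_left_commute[of 2 d 1 d])
  \<comment> \<open>\<open>T\<close> replaces each massive generator by a form in the kernel of
    \<open>w\<close>. Its \<open>d\<close> component dies under \<open>?D\<close>, so only
    \<open>h\<close> and \<open>hb\<close> survive.\<close>
  have "\<exists>g\<in>gpolys G. ?D (T f) = ?D g" for f
  proof (induction f rule: grassmann_induct)
    case zero
    have "0 \<in> gpolys G" using gpolys.const[of 0 G] by simp
    then show ?case by (intro bexI[of _ 0]) (simp_all add: T_def elim_rules)
  next
    case one
    have "1 \<in> gpolys G" using gpolys.const[of 1 G] by simp
    then show ?case by (intro bexI[of _ 1]) (simp_all add: T_def elim_rules)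
  next
    case (add f g)
    then obtain f' g' where "f' \<in> gpolys G" "?D (T f) = ?D f'" "g' \<in> gpolys G" "?D (T g) = ?D g'"
      by blast
    then show ?case
      by (intro bexI[of _ "f' + g'"]) (simp_all add: T_def elim_rules distrib_left gpolys.add)
  next
    case (scale c f)
    then obtain f' where "f' \<in> gpolys G" "?D (T f) = ?D f'" by blast
    then show ?case
      by (intro bexI[of _ "c *\<^sub>C f'"]) (simp_all add: T_def elim_rules gscale_mult_right gpolys_gscale)
  next
    case (gvar a f)
    then obtain g where g: "g \<in> gpolys G" "?D (T f) = ?D g" by blast
    show ?case
    proof (cases a)
      case (EtaP A)
      have "?D (T (gvar a * f)) = ?D (etaP A * g)"
        using g(2) by (simp add: EtaP T_def elim_rules commP)
      moreover have "etaP A * g \<in> gpolys G"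
        by (intro gpolys.mult gens g(1))
      ultimately show ?thesis by blast
    next
      case (Eta A i I)
      have "gvar a = lform A (\<lambda>j J. if j = i \<and> J = I then 1 else 0)"
        using exhaust_2[of i] exhaust_2[of I]
        by (intro grassmann_eqI) (auto simp: Eta lform_def sum_2 gcoeff_linear)
      then obtain v where v: "pairing w v = 0" "T (gvar a * f) = lform A v * T f"
        using T_lform by metis
      obtain p b c where "\<forall>i I. v i I = p * d i I + (b * h i I + c * hb i I)"
        using ker[OF v(1)] by blast
      then have "v = (\<lambda>i I. p * d i I + (b * h i I + c * hb i I))" by (simp add: fun_eq_iff)
      then have lv: "lform A v = p *\<^sub>C lform A d + (b *\<^sub>C lform A h + c *\<^sub>C lform A hb)"
        by (simp add: lform_add lform_scale)
      let ?g = "(b *\<^sub>C lform A h + c *\<^sub>C lform A hb) * g"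
      have "?D (T (gvar a * f)) = ?D (lform A v * T f)" by (simp add: v)
      also have "\<dots> = lform A v * ?D g" by (simp only: comm g(2))
      also have "\<dots> = ?D (lform A v * g)" by (simp only: comm)
      also have "\<dots> = p *\<^sub>C ?D (lform A d * g) + ?D ?g"
        by (simp add: lv distrib_right distrib_left gscale_mult_left gscale_mult_right)
      finally have "?D (T (gvar a * f)) = ?D ?g" by (simp only: D_d) simp
      moreover have "?g \<in> gpolys G"
        by (intro gpolys.mult gpolys.add gpolys_gscale gens g(1))
      ultimately show ?thesis by blast
    qed
  qed
  moreover have "M = ?D (T N)"
  proof -
    \<comment> \<open>\<open>N\<close> itself need not be annihilated by the derivatives. It may be
      replaced by \<open>T N\<close> because \<open>T\<close> fixes \<open>M\<close> and commutes
      with multiplication by the forms of \<open>d\<close>.\<close>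
    have "M = T M" by (simp add: T_def elim_fixes[OF wk] M(2,3))
    also have "\<dots> = ?D (T N)" by (simp only: M(1) T_ann[OF wd])
    finally show ?thesis .
  qed
  ultimately show ?thesis by metis
qed

section \<open>Spinor geometry\<close>

lemma angle_expand: "angle u v = u $ 2 * v $ 1 - u $ 1 * v $ 2"
  by (simp add: angle_def raise_def sum_2 eps_up_def)

lemma square_expand: "square u v = u $ 1 * v $ 2 - u $ 2 * v $ 1"
  by (simp add: square_def raise_def sum_2 eps_up_def)

lemma angle_eq_0_imp_multiple:
  assumes "angle u v = 0" "u \<noteq> 0"
  shows "\<exists>t. \<forall>a. v $ a = t * u $ a"
proof (cases "u $ 1 = 0")
  case True
  then have "u $ 2 \<noteq> 0" using assms(2) by (auto simp: vec_eq_iff forall_2)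
  then show ?thesis using assms(1) True
    by (intro exI[of _ "v $ 2 / u $ 2"]) (auto simp: forall_2 angle_expand)
next
  case False
  then show ?thesis using assms(1)
    by (intro exI[of _ "v $ 1 / u $ 1"]) (auto simp: forall_2 angle_expand field_simps)
qed

text \<open>With the mass normalisation, \<open>l i 1\<close> and \<open>l i 2\<close> form a basis,
  so any coefficients \<open>u i I\<close> are the brackets of one spinor with \<open>l i I\<close>.
  This formula is that spinor.\<close>

definition spinor_of :: "real \<Rightarrow> (2 \<Rightarrow> 2 \<Rightarrow> spinor) \<Rightarrow> (2 \<Rightarrow> 2 \<Rightarrow> complex) \<Rightarrow> 2 \<Rightarrow> spinor" where
  "spinor_of m l u i =
     (\<chi> a. - (1 / complex_of_real m) * (\<Sum>J\<in>UNIV. \<Sum>K\<in>UNIV. u i J * eps_dn J K * l i K $ a))"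

lemma angle_spinor_of:
  assumes "m > 0" and "\<And>I J. angle (l i I) (l i J) = - complex_of_real m * eps_up I J"
  shows "angle (spinor_of m l u i) (l i I) = u i I"
proof -
  have "angle (spinor_of m l u i) (l i I) =
      - (1 / complex_of_real m) * (\<Sum>J\<in>UNIV. \<Sum>K\<in>UNIV. u i J * eps_dn J K * angle (l i K) (l i I))"
    unfolding angle_expand spinor_of_def by (simp add: sum_2 algebra_simps)
  also have "\<dots> = u i I"
    unfolding assms(2) using assms(1) exhaust_2[of I] by (auto simp: sum_2 eps_dn_def eps_up_def)
  finally show ?thesis .
qed

text \<open>The coefficients of the derivative to which the contractions of the supercharges with the
  massless spinors reduce.\<close>

definition Pderiv :: "(2 \<Rightarrow> 2 \<Rightarrow> spinor) \<Rightarrow> spinor \<Rightarrow> 2 \<Rightarrow> 2 \<Rightarrow> complex" where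
  "Pderiv l lP i J = sig i * (\<Sum>I\<in>UNIV. angle lP (l i I) * eps_dn I J)"

text \<open>It turns membership in the kernel into a statement on spinors: those of the two
  particles differ by a multiple of \<open>lP\<close> when \<open>lP\<close> is nonzero.\<close>

lemma pairing_Pderiv:
  assumes "m > 0"
  shows "pairing (Pderiv l lP) u =
    complex_of_real m * (angle lP (spinor_of m l u 1) - angle lP (spinor_of m l u 2))"
  using assms unfolding angle_expand spinor_of_def pairing_def Pderiv_def
  by (simp add: sum_2 sig_def eps_dn_def field_simps)

section \<open>Kinematics under momentum conservation\<close>

context
  fixes m :: real and l lt :: "2 \<Rightarrow> 2 \<Rightarrow> spinor" and lP ltP :: spinor
  assumes m: "m > 0"
    and angle_mass: "\<And>i I J. angle (l i I) (l i J) = - complex_of_real m * eps_up I J"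
    and P_nonzero: "lP \<noteq> 0"
    and conservation:
      "massive_momentum l lt 1 + massive_momentum l lt 2 + massless_momentum lP ltP = 0"
begin

lemma conservation_component:
  "massive_momentum l lt 1 $ a $ d + massive_momentum l lt 2 $ a $ d = - (lP $ a * ltP $ d)"
proof -
  have "(massive_momentum l lt 1 + massive_momentum l lt 2 + massless_momentum lP ltP) $ a $ d = 0"
    using conservation by simp
  then show ?thesis by (simp add: massless_momentum_def add_eq_0_iff)
qed

text \<open>Represent \<open>u\<close> by spinors \<open>\<psi> i\<close> and the brackets with
  \<open>\<xi>\<close> by \<open>\<rho> i\<close>. In the kernel, \<open>\<psi> 1 - \<psi> 2\<close>
  is \<open>t\<close> times \<open>lP\<close>, while momentum conservation makes
  \<open>\<rho> 1 + \<rho> 2\<close> equal to \<open>\<tau>\<close> times \<open>lP\<close>. Since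
  \<open>sig\<close> flips the second sign, subtracting \<open>t / \<tau>\<close> times the barred
  form leaves one spinor \<open>\<phi>\<close> common to both particles, a combination of
  \<open>lP\<close> and \<open>\<zeta>\<close>.\<close>

lemma ker_Pderiv:
  assumes "angle \<zeta> lP \<noteq> 0" "square \<xi> ltP \<noteq> 0" "pairing (Pderiv l lP) u = 0"
  shows "\<exists>a b c. \<forall>i I. u i I =
    a * angle lP (l i I) + (b * angle \<zeta> (l i I) + c * (square \<xi> (lt i I) * sig i))"
proof -
  define v where "v i I = square \<xi> (lt i I)" for i I
  define \<psi> where "\<psi> = spinor_of m l u"
  define \<rho> where "\<rho> = spinor_of m l v"
  have m0: "complex_of_real m \<noteq> 0" using m by simp
  have u: "u i I = angle (\<psi> i) (l i I)" and v: "v i I = angle (\<rho> i) (l i I)" for i I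
    by (simp_all add: \<psi>_def \<rho>_def angle_spinor_of[where l = l, OF m angle_mass])
  have "angle lP (\<psi> 1) = angle lP (\<psi> 2)"
    using assms(3) m by (simp add: pairing_Pderiv[OF m] \<psi>_def)
  then have "angle lP (\<psi> 1 - \<psi> 2) = 0" by (simp add: angle_expand algebra_simps)
  then obtain t where t: "\<And>a. \<psi> 1 $ a = \<psi> 2 $ a + t * lP $ a"
    using angle_eq_0_imp_multiple[OF _ P_nonzero] by (metis add.commute diff_add_cancel vector_minus_component)
  \<comment> \<open>The factor comes from contracting the conservation law with
    \<open>\<xi>\<close>. The choice of reference spinor makes it nonzero.\<close>
  define \<tau> where "\<tau> = - square \<xi> ltP / complex_of_real m"
  have \<tau>: "\<tau> \<noteq> 0" using assms(2) m by (simp add: \<tau>_def)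
  have \<rho>_mom: "\<rho> i $ a = 1 / complex_of_real m *
      (massive_momentum l lt i $ a $ 2 * \<xi> $ 1 - massive_momentum l lt i $ a $ 1 * \<xi> $ 2)" for i a
    using m0 by (simp add: \<rho>_def v_def spinor_of_def massive_momentum_def square_expand sum_2 eps_dn_def
        field_simps)
  have \<rho>_sum: "\<rho> 1 $ a = \<tau> * lP $ a - \<rho> 2 $ a" for a
  proof -
    have "\<rho> 1 $ a + \<rho> 2 $ a = 1 / complex_of_real m *
       ((massive_momentum l lt 1 $ a $ 2 + massive_momentum l lt 2 $ a $ 2) * \<xi> $ 1
        - (massive_momentum l lt 1 $ a $ 1 + massive_momentum l lt 2 $ a $ 1) * \<xi> $ 2)"
      unfolding \<rho>_mom by (simp add: algebra_simps)
    also have "\<dots> = \<tau> * lP $ a"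
      unfolding conservation_component using m0 by (simp add: \<tau>_def square_expand field_simps)
    finally show ?thesis by (simp add: eq_diff_eq)
  qed
  define \<phi> where "\<phi> = \<psi> 2 + (\<chi> a. (t / \<tau>) * \<rho> 2 $ a)"
  have u_eq: "u i I = angle \<phi> (l i I) + t / \<tau> * (square \<xi> (lt i I) * sig i)" for i I
  proof (cases "i = 1")
    case True
    show ?thesis using \<tau>
      by (simp add: True flip: v_def) (simp add: u v t \<rho>_sum \<phi>_def angle_expand sig_def field_simps)
  next
    case False
    then have "i = 2" using exhaust_2[of i] by simp
    then show ?thesis using \<tau>
      by (simp flip: v_def) (simp add: u v \<phi>_def angle_expand sig_def field_simps)
  qed
  have "angle \<phi> q = angle \<zeta> \<phi> / angle \<zeta> lP * angle lP q + angle \<phi> lP / angle \<zeta> lP * angle \<zeta> q" for q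
  proof -
    \<comment> \<open>The Schouten identity: three vectors in a plane are linearly
      dependent.\<close>
    have "angle \<zeta> lP * angle \<phi> q = angle \<zeta> \<phi> * angle lP q + angle \<phi> lP * angle \<zeta> q"
      by (simp add: angle_expand algebra_simps)
    then show ?thesis using assms(1) by (simp add: field_simps)
  qed
  then show ?thesis using u_eq by (metis add.assoc)
qed

text \<open>Otherwise both spinors of particle 1 would be multiples of \<open>lP\<close>, and their
  mutual bracket would vanish instead of being \<open>-m\<close>.\<close>

lemma exists_angle_nonzero: "\<exists>I. angle lP (l 1 I) \<noteq> 0"
proof (rule ccontr)
  assume "\<not> ?thesis"
  then have z: "angle lP (l 1 I) = 0" for I by auto
  obtain a b where "\<And>c. l 1 1 $ c = a * lP $ c" "\<And>c. l 1 2 $ c = b * lP $ c"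
    using angle_eq_0_imp_multiple[OF z P_nonzero] by metis
  then have "angle (l 1 1) (l 1 2) = 0" by (simp add: angle_expand)
  then show False using m by (simp add: angle_mass eps_up_def)
qed

text \<open>For each particle a product symmetric in the little-group indices is contracted with the
  antisymmetric \<open>eps_dn\<close>.\<close>

lemma pairing_Pderiv_delta: "pairing (Pderiv l lP) (\<lambda>i I. angle lP (l i I)) = 0"
  by (simp add: pairing_def Pderiv_def sum_2 eps_dn_def algebra_simps)

lemma exists_Pderiv_nonzero: "\<exists>J. Pderiv l lP 1 J \<noteq> 0"
proof -
  have "Pderiv l lP 1 1 = angle lP (l 1 2)" "Pderiv l lP 1 2 = - angle lP (l 1 1)"
    by (simp_all add: Pderiv_def sum_2 eps_dn_def sig_def)
  then show ?thesis using exists_angle_nonzero by (metis exhaust_2 neg_equal_0_iff_equal)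
qed

text \<open>For particle 2, conservation replaces its momentum by minus that of particle 1, since
  the massless momentum contracts to zero with \<open>raise ltP\<close>; hence the sign
  \<open>sig i\<close>. Contraction with \<open>l i K\<close> then isolates the square
  bracket.\<close>

lemma square_P_eq:
  assumes x_def: "\<And>a. x * lP $ a =
      1 / complex_of_real m * (\<Sum>d\<in>UNIV. massive_momentum l lt 1 $ a $ d * raise ltP $ d)"
  shows "square (lt i K) ltP = x * sig i * angle lP (l i K)"
proof -
  have m0: "complex_of_real m \<noteq> 0" using m by simp
  have mom: "x * sig i * lP $ a =
      1 / complex_of_real m * (\<Sum>d\<in>UNIV. massive_momentum l lt i $ a $ d * raise ltP $ d)" for a
  proof (cases "i = 1")
    case True
    then show ?thesis using x_def[of a] by (simp add: sig_def)
  next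
    case False
    then have i: "i = 2" using exhaust_2[of i] by simp
    have p2: "massive_momentum l lt 2 $ a $ d = - (lP $ a * ltP $ d) - massive_momentum l lt 1 $ a $ d" for d
      using conservation_component[of a d] by (simp add: algebra_simps)
    show ?thesis using x_def[of a] m0 unfolding i p2
      by (simp add: sig_def sum_2 raise_def eps_up_def field_simps)
  qed
  have "x * sig i * angle (l i K) lP = l i K $ 2 * (x * sig i * lP $ 1) - l i K $ 1 * (x * sig i * lP $ 2)"
    by (simp add: angle_expand algebra_simps)
  also have "\<dots> = 1 / complex_of_real m *
      (\<Sum>I\<in>UNIV. \<Sum>J\<in>UNIV. angle (l i K) (l i I) * eps_dn I J * square (lt i J) ltP)"
    unfolding mom by (simp add: massive_momentum_def angle_expand square_expand sum_2 raise_def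
        eps_up_def diff_divide_distrib add_divide_distrib algebra_simps)
  also have "\<dots> = - square (lt i K) ltP"
    unfolding angle_mass using m0 exhaust_2[of K] by (auto simp: sum_2 eps_up_def eps_dn_def)
  finally show ?thesis by (simp add: angle_expand algebra_simps)
qed

end

section \<open>Contraction of the supercharges\<close>

lemma delta_eq_lform: "delta l lP A = lform A (\<lambda>i I. angle lP (l i I))"
  by (simp add: delta_def lform_def)

text \<open>The \<open>etaP\<close> term drops out because \<open>angle lP lP\<close> is
  zero.\<close>

lemma superQ_contract:
  "(\<Sum>\<alpha>\<in>UNIV. raise lP $ \<alpha> *\<^sub>C superQ \<theta> l lP A \<alpha> f) =
    complex_of_real (cos \<theta>) *\<^sub>C (delta l lP A * f)
    + complex_of_real (sin \<theta>) *\<^sub>C (\<Sum>B\<in>UNIV. eps_up A B *\<^sub>C dform B (Pderiv l lP) f)"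
  by (rule grassmann_eqI)
    (simp add: superQ_def delta_eq_lform lform_mult dform_def Pderiv_def deriv_upI_lowA_def sum_2
      angle_expand raise_def eps_up_def eps_dn_def sig_def gcoeff_linear algebra_simps)

text \<open>The massless derivative drops out likewise. The proportionality of brackets makes the
  same \<open>delta\<close> and \<open>Pderiv\<close> appear as for \<open>superQ\<close>, so the
  two charges give a closed system.\<close>

lemma superQt_contract:
  assumes "\<And>i I. square (lt i I) ltP = x * sig i * angle lP (l i I)"
  shows "(\<Sum>\<alpha>\<in>UNIV. raise ltP $ \<alpha> *\<^sub>C superQt \<theta> lt ltP \<alpha> A f) =
    (- x) *\<^sub>C (complex_of_real (cos \<theta>) *\<^sub>C dform A (Pderiv l lP) f
    + complex_of_real (sin \<theta>) *\<^sub>C (\<Sum>B\<in>UNIV. eps_dn A B *\<^sub>C (delta l lP B * f)))"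
proof -
  have "(\<Sum>\<alpha>\<in>UNIV. raise ltP $ \<alpha> *\<^sub>C superQt \<theta> lt ltP \<alpha> A f) =
    (\<Sum>i\<in>UNIV. \<Sum>I\<in>UNIV. square (lt i I) ltP *\<^sub>C
        (complex_of_real (cos \<theta>) *\<^sub>C deriv_upIA i I A f
         - (complex_of_real (sin \<theta>) * sig i) *\<^sub>C (eta_low i I A * f)))"
    by (rule grassmann_eqI)
      (simp add: superQt_def sum_2 square_expand raise_def eps_up_def gcoeff_linear algebra_simps)
  then show ?thesis
    unfolding assms
    by (intro grassmann_eqI)
      (simp add: delta_eq_lform lform_mult dform_def Pderiv_def deriv_upIA_def eta_low_def sum_2
        distrib_right gscale_mult_left eps_dn_def sig_def gcoeff_linear algebra_simps)
qed

theorem mainTheorem1: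
  fixes m \<theta> :: real and x :: complex
    and l lt :: "2 \<Rightarrow> 2 \<Rightarrow> spinor" and lP ltP \<zeta> \<xi> :: spinor
    and M :: "gen grassmann"
  assumes m: "m > 0"
    and angle_mass: "\<And>i I J. angle (l i I) (l i J) = - complex_of_real m * eps_up I J"
    and square_mass: "\<And>i I J. square (lt i I) (lt i J) = complex_of_real m * eps_up I J"
    and P_nonzero: "lP \<noteq> 0" "ltP \<noteq> 0"
    and conservation:
      "massive_momentum l lt 1 + massive_momentum l lt 2 + massless_momentum lP ltP = 0"
    and x_nonzero: "x \<noteq> 0"
    and x_def: "\<And>a. x * lP $ a =
      1 / complex_of_real m * (\<Sum>d\<in>UNIV. massive_momentum l lt 1 $ a $ d * raise ltP $ d)"
    and reference: "angle \<zeta> lP \<noteq> 0" "square \<xi> ltP \<noteq> 0"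
    and theta: "\<theta> \<in> {- (pi / 4)<..<pi / 4}"
    and susy_Q: "\<And>A \<alpha>. superQ \<theta> l lP A \<alpha> M = 0"
    and susy_Qt: "\<And>\<alpha> A. superQt \<theta> lt ltP \<alpha> A M = 0"
  shows "\<exists>Mres \<in> gpolys (range (calH \<zeta> l lP) \<union> range (calHbar \<xi> lt ltP) \<union> range etaP).
           M = delta l lP 1 * delta l lP 2 * Mres"
proof -
  let ?c = "complex_of_real (cos \<theta>)" and ?s = "complex_of_real (sin \<theta>)"
  let ?d = "\<lambda>i I. angle lP (l i I)" and ?w = "Pderiv l lP"
  let ?h = "\<lambda>i I. 1 / angle \<zeta> lP * angle \<zeta> (l i I)"
  let ?hb = "\<lambda>i I. 1 / square \<xi> ltP * (square \<xi> (lt i I) * sig i)"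
  note kin = m angle_mass P_nonzero(1) conservation
  have "cos (2 * \<theta>) > 0" using theta by (intro cos_gt_zero_pi) auto
  then have cs: "?c * ?c - ?s * ?s \<noteq> 0"
    by (simp add: cos_double power2_eq_square flip: of_real_mult of_real_diff)
  have Q: "?c *\<^sub>C (delta l lP A * M) + ?s *\<^sub>C (\<Sum>B\<in>UNIV. eps_up A B *\<^sub>C dform B ?w M) = 0" for A
    unfolding superQ_contract[symmetric] by (simp add: susy_Q)
  have Qt: "(- x) *\<^sub>C (?c *\<^sub>C dform A ?w M + ?s *\<^sub>C (\<Sum>B\<in>UNIV. eps_dn A B *\<^sub>C (delta l lP B * M))) = 0" for A
    unfolding superQt_contract[OF square_P_eq[OF kin x_def], symmetric] by (simp add: susy_Qt)
  have lin: "a = 0 \<and> b = 0" if "?c * a + ?s * b = 0" "?c * b + ?s * a = 0" for a b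
  proof -
    have "(?c * ?c - ?s * ?s) * a = ?c * (?c * a + ?s * b) - ?s * (?c * b + ?s * a)"
      "(?c * ?c - ?s * ?s) * b = ?c * (?c * b + ?s * a) - ?s * (?c * a + ?s * b)"
      by (simp_all add: algebra_simps)
    then show ?thesis using that cs by simp
  qed
  have ann: "gcoeff (delta l lP A * M) S = 0 \<and> gcoeff (dform A ?w M) S = 0" for A S
  proof -
    \<comment> \<open>Taking coefficients reduces the equations to linear systems over the complex
      numbers.\<close>
    have Q': "gcoeff (?c *\<^sub>C (delta l lP B * M) + ?s *\<^sub>C (\<Sum>B'\<in>UNIV. eps_up B B' *\<^sub>C dform B' ?w M)) S = 0"
      and Qt': "gcoeff (?c *\<^sub>C dform B ?w M + ?s *\<^sub>C (\<Sum>B'\<in>UNIV. eps_dn B B' *\<^sub>C (delta l lP B' * M))) S = 0" for B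
      using Q[of B] arg_cong[OF Qt[of B], of "\<lambda>g. gcoeff g S"] x_nonzero
      by (simp_all add: gcoeff_linear)
    \<comment> \<open>The \<open>eps\<close> symbols couple \<open>delta\<close> of one flavour to
      the derivative of the other. In the second pair the unknown is minus the derivative, which
      restores the form required by \<open>lin\<close>.\<close>
    have "gcoeff (delta l lP 1 * M) S = 0 \<and> gcoeff (dform 2 ?w M) S = 0"
      using Q'[of 1] Qt'[of 2] by (intro lin) (simp_all add: gcoeff_linear sum_2 eps_up_def eps_dn_def)
    moreover have "gcoeff (delta l lP 2 * M) S = 0 \<and> - gcoeff (dform 1 ?w M) S = 0"
      using Q'[of 2] Qt'[of 1]
      by (intro lin)
        (simp_all add: gcoeff_linear sum_2 eps_up_def eps_dn_def add_eq_0_iff neg_eq_iff_add_eq_0)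
    ultimately show ?thesis using exhaust_2[of A] by auto
  qed
  have d0: "lform A ?d * M = 0" and w0: "dform A ?w M = 0" for A
    using ann by (auto intro!: grassmann_eqI simp: gcoeff_linear simp flip: delta_eq_lform)
  obtain I where "angle lP (l 1 I) \<noteq> 0" using exists_angle_nonzero[OF kin] by blast
  then obtain N where N: "M = lform 1 ?d * (lform 2 ?d * N)"
    using annihilated_factor[of ?d 1 I M] d0 by auto
  obtain k where k: "pairing ?w k = 1"
    using exists_Pderiv_nonzero[OF kin] exists_dual(2) by metis
  have ker: "\<exists>a b c. \<forall>i I. u i I = a * ?d i I + (b * ?h i I + c * ?hb i I)" if u: "pairing ?w u = 0" for u
  proof -
    obtain a b c where
      "\<forall>i I. u i I = a * ?d i I + (b * angle \<zeta> (l i I) + c * (square \<xi> (lt i I) * sig i))"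
      using ker_Pderiv[OF kin reference u] by blast
    then show ?thesis using reference
      by (intro exI[of _ a] exI[of _ "b * angle \<zeta> lP"] exI[of _ "c * square \<xi> ltP"]) simp
  qed
  have H: "calH \<zeta> l lP = (\<lambda>A. lform A ?h)" "calHbar \<xi> lt ltP = (\<lambda>A. lform A ?hb)"
    unfolding lform_scale by (simp_all add: fun_eq_iff calH_def calHbar_def lform_def)
  obtain g where "g \<in> gpolys (range (\<lambda>A. lform A ?h) \<union> range (\<lambda>A. lform A ?hb) \<union> range etaP)"
    "M = lform 1 ?d * (lform 2 ?d * g)"
    using factor_polynomial[OF k pairing_Pderiv_delta[OF kin] ker N w0 w0] by blast
  then show ?thesis unfolding H delta_eq_lform by (auto simp: mult.assoc)
qed

end
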